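(* Suppose the a priori attitude distribution is given by $\mathcal{M}(F)$ with a matrix parameter $F\in\mathbb{R}^{3\times3}$. Consider a set of attitude measurements $\{Z_1,\ldots,Z_{N_Z}\}\in\mathsf{SO(3)}^{N_Z}$ distributed by $$p(Z_i|R)=\frac{1}{c(F_{Z_i})}\exp(\mathrm{tr}[F_{Z_i}^TR^TZ_i])$$ for some $(F_{Z_1},\ldots,F_{Z_{N_Z}})\in(\mathbb{R}^{3\times3})^{N_Z}$, and a set of direction measurements $\{z_1,\ldots,z_{N_z}\}\in(\mathsf{S}^2)^{N_z}$ following $$p(z_i|R)=\frac{b_i}{4\pi\sinh b_i}\exp(b_ia_i^TB_i^TRz_i)$$ for some $\{(b_i,B_i)\}_{i=1}^{N_z}\in(\mathbb{R},\mathsf{SO(3)})^{N_z}$ with $b_i>0$. All of the attitude measurements and direction measurements are mutually independent. Then the a posteriori distribution for $R|(Z_1,\ldots,Z_{N_Z},z_1,\ldots,z_{N_z})$ conditioned by all of the measurements is also a matrix Fisher distribution. Specifically, $$R\,|\,(Z_1,\ldots,Z_{N_Z},z_1,\ldots,z_{N_z})\sim\mathcal{M}\Big(F+\sum_{i=1}^{N_Z}Z_iF_{Z_i}^T+\sum_{j=1}^{N_z}b_jB_ja_jz_j^T\Big).$$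
   Context: $\mathsf{SO(3)}=\{R\in\mathbb{R}^{3\times3}\mid R^TR=I_{3\times3},\det R=1\}$ carries the Haar measure $dR$ normalized by $\int_{\mathsf{SO(3)}}dR=1$. For $F\in\mathbb{R}^{3\times3}$, $R\sim\mathcal{M}(F)$ (matrix Fisher distribution) means that $R\in\mathsf{SO(3)}$ has density $p(R)=\frac{1}{c(F)}\exp(\mathrm{tr}[F^TR])$ relative to the uniform distribution on $\mathsf{SO(3)}$ (i.e. with respect to $dR$), where $c(F)=\int_{\mathsf{SO(3)}}\exp(\mathrm{tr}[F^TR])\,dR$. $\mathsf{S}^2$ is the set of unit vectors in $\mathbb{R}^3$. The density $p(Z_i|R)$ is the probability density of the $i$-th attitude measurement $Z_i\in\mathsf{SO(3)}$ conditioned by the true attitude $R$; equivalently, the measurement error $R^TZ_i$ follows $\mathcal{M}(F_{Z_i})$. The vector $a_i\in\mathsf{S}^2$ is the $i$-th known direction resolved in the inertial frame, and $z_i\in\mathsf{S}^2$ is its measurement resolved in the body-fixed frame. The conditional density $p(z_i|R)$ is referred to as the von Mises-Fisher distribution on $\mathsf{S}^2$ and is defined relative to the uniform distribution on $\mathsf{S}^2$. *)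

theory Defs
  imports "HOL-Probability.Probability"
begin

definition SO3 :: "(real^3^3) set" where
  "SO3 = {R. transpose R ** R = mat 1 \<and> det R = 1}"

text \<open>
  The normalized Haar measure on the compact group \<open>SO3\<close>: the unique left-invariant Borel
  probability measure. It lives on the subspace \<open>SO3\<close>, not on all matrices.
\<close>

definition normalized_haar_SO3 :: "(real^3^3) measure \<Rightarrow> bool" where
  "normalized_haar_SO3 \<mu> \<longleftrightarrow>
     sets \<mu> = sets (restrict_space borel SO3) \<and>
     emeasure \<mu> SO3 = 1 \<and>
     (\<forall>Q\<in>SO3. distr \<mu> \<mu> (\<lambda>R. Q ** R) = \<mu>)"

definition fisher_const :: "(real^3^3) measure \<Rightarrow> real^3^3 \<Rightarrow> real" where
  "fisher_const haar F = (\<integral>R. exp (trace (transpose F ** R)) \<partial>haar)"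

definition fisher_density :: "(real^3^3) measure \<Rightarrow> real^3^3 \<Rightarrow> real^3^3 \<Rightarrow> real" where
  "fisher_density haar F R = exp (trace (transpose F ** R)) / fisher_const haar F"

definition matrix_fisher :: "(real^3^3) measure \<Rightarrow> real^3^3 \<Rightarrow> (real^3^3) measure" where
  "matrix_fisher haar F = density haar (\<lambda>R. ennreal (fisher_density haar F R))"

abbreviation S2 :: "(real^3) set" where
  "S2 \<equiv> sphere 0 1"

text \<open>
  The uniform distribution on the sphere is the law of \<open>x / norm x\<close> for \<open>x\<close> uniform in the
  punctured unit ball.
\<close>

definition uniform_S2 :: "(real^3) measure" where
  "uniform_S2 =
     distr (restrict_space (uniform_measure lborel (ball 0 1)) (ball 0 1 - {0}))
       (restrict_space borel S2) sgn"

text \<open>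
  The surface area measure, of total mass \<open>4 * pi\<close>. It is the reference measure for which
  \<open>b / (4 * pi * sinh b)\<close> is the normalizing factor of the von Mises-Fisher density; relative
  to the probability measure \<open>uniform_S2\<close> the factor would be \<open>b / sinh b\<close>.
\<close>

definition area_S2 :: "(real^3) measure" where
  "area_S2 = scale_measure (ennreal (4 * pi)) uniform_S2"

definition outer_prod :: "real^3 \<Rightarrow> real^3 \<Rightarrow> real^3^3" where
  "outer_prod u v = (columnvector u :: real^1^3) ** (rowvector v :: real^3^1)"

text \<open>The conditional probability of the event \<open>E\<close> given the sub-sigma-algebra \<open>G\<close>.\<close>

definition cond_prob_of :: "'w measure \<Rightarrow> 'w measure \<Rightarrow> 'w set \<Rightarrow> 'w \<Rightarrow> real" where
  "cond_prob_of M G E = real_cond_exp M G (indicator E)"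

definition gen_by :: "'w measure \<Rightarrow> 'b measure \<Rightarrow> ('w \<Rightarrow> 'b) \<Rightarrow> 'w measure" where
  "gen_by M T Y = vimage_algebra (space M) Y T"

text \<open>
  The Markov kernel \<open>K\<close> is a (regular) conditional distribution of \<open>X\<close> given \<open>Y\<close>. Like every
  conditional distribution, it is determined up to null sets of the law of \<open>Y\<close>.
\<close>

definition cond_distr ::
    "'w measure \<Rightarrow> 'a measure \<Rightarrow> ('w \<Rightarrow> 'a) \<Rightarrow> 'b measure \<Rightarrow> ('w \<Rightarrow> 'b) \<Rightarrow> ('b \<Rightarrow> 'a measure) \<Rightarrow> bool" where
  "cond_distr M S X T Y K \<longleftrightarrow>
     X \<in> measurable M S \<and> Y \<in> measurable M T \<and> K \<in> measurable T (prob_algebra S) \<and>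
     (\<forall>A\<in>sets S. AE w in M.
        cond_prob_of M (gen_by M T Y) (X -` A \<inter> space M) w = measure (K (Y w)) A)"

text \<open>The conditional analogue of \<open>prob_space.indep_sets\<close>, given the sub-sigma-algebra \<open>G\<close>.\<close>

definition cond_indep_sets ::
    "'w measure \<Rightarrow> 'w measure \<Rightarrow> ('i \<Rightarrow> 'w set set) \<Rightarrow> 'i set \<Rightarrow> bool" where
  "cond_indep_sets M G E I \<longleftrightarrow>
     (\<forall>i\<in>I. E i \<subseteq> sets M) \<and>
     (\<forall>J\<subseteq>I. J \<noteq> {} \<longrightarrow> finite J \<longrightarrow> (\<forall>A\<in>Pi J E. AE w in M.
        cond_prob_of M G (\<Inter>j\<in>J. A j) w = (\<Prod>j\<in>J. cond_prob_of M G (A j) w)))"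

end

theory Submission
  imports Defs
begin

text \<open>
  The result is Bayes' rule for an exponential family that is closed under multiplication of
  likelihoods. With the Frobenius inner product on matrices, which is the standard inner product
  of the type, the prior weight is \<open>exp (F \<bullet> R)\<close> since \<open>tr (F\<^sup>T R) = F \<bullet> R\<close>
  (\<open>trace_transpose_mult\<close>). As functions of \<open>R\<close>, both likelihoods are exponentials of
  linear forms as well: \<open>tr (F\<^sub>Z\<^sup>T R\<^sup>T Z) = R \<bullet> (Z F\<^sub>Z\<^sup>T)\<close> (\<open>trace_attitude\<close>) and
  \<open>a\<^sup>T B\<^sup>T R z = R \<bullet> ((B a) z\<^sup>T)\<close> (\<open>inner_direction\<close>). Multiplying prior and
  likelihoods adds the matrices in the exponents, so the product is the matrix Fisher density of
  the sum, up to a factor that depends on the measurements only.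

  What remains is to turn this pointwise identity into a statement on conditional distributions,
  in the sense of conditional expectations given generated sigma-algebras. This takes two general
  facts. Conditional independence and the conditional densities given \<open>X\<close> determine the joint law
  of \<open>X\<close> and all observations: its density with respect to the product measure is the product of
  the density of \<open>X\<close> and of the conditional densities (\<open>joint_law_of_cond_indep\<close>). And whenever a
  joint density factors as \<open>k y x * m y\<close> with \<open>k y\<close> a probability density for every \<open>y\<close>, the
  kernel with density \<open>k\<close> is the conditional distribution of the first component given the second
  (\<open>cond_distr_of_joint_density\<close>).
\<close>

section \<open>The joint law of conditionally independent observations\<close>

lemma subalgebra_gen_by:
  assumes "Y \<in> measurable M T"
  shows "subalgebra M (gen_by M T Y)"
  using assms measurable_space[OF assms]
  by (auto simp: subalgebra_def gen_by_def sets_vimage_algebra2 Pi_def intro: measurable_sets)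

lemma sets_gen_by:
  assumes "Y \<in> measurable M T"
  shows "sets (gen_by M T Y) = {Y -` C \<inter> space M |C. C \<in> sets T}"
  using measurable_space[OF assms] unfolding gen_by_def
  by (subst sets_vimage_algebra2) auto

text \<open>
  Integrating the product formula for conditional probabilities over an event \<open>X \<in> E\<close>, which
  belongs to the conditioning sigma-algebra, removes the conditional expectations. The formula is
  then one about the law of \<open>X\<close> alone. For empty \<open>J\<close>, where the intersection is the whole type,
  it is the definition of that law.
\<close>

lemma emeasure_cond_indep_inter:
  fixes M :: "'w measure" and X :: "'w \<Rightarrow> 'x" and k :: "'i \<Rightarrow> 'x \<Rightarrow> real"
  assumes M: "prob_space M" and X[measurable]: "X \<in> measurable M S"
    and indep: "cond_indep_sets M (gen_by M S X) \<E> J"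
    and fin: "finite J" and A: "\<And>j. j \<in> J \<Longrightarrow> A j \<in> \<E> j"
    and k_meas[measurable]: "\<And>j. j \<in> J \<Longrightarrow> k j \<in> borel_measurable S"
    and k_bounds: "\<And>j x. j \<in> J \<Longrightarrow> x \<in> space S \<Longrightarrow> 0 \<le> k j x \<and> k j x \<le> 1"
    and k: "\<And>j. j \<in> J \<Longrightarrow> AE w in M. cond_prob_of M (gen_by M S X) (A j) w = k j (X w)"
    and E[measurable]: "E \<in> sets S"
  shows "emeasure M ((X -` E \<inter> space M) \<inter> (\<Inter>j\<in>J. A j)) =
    (\<integral>\<^sup>+ x. indicator E x * ennreal (\<Prod>j\<in>J. k j x) \<partial>distr M S X)"
proof -
  interpret prob_space M by (rule M)
  interpret finite_measure_subalgebra M "gen_by M S X"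
    by unfold_locales (rule subalgebra_gen_by[OF X])
  \<comment> \<open>the intersection with the space makes the empty family unexceptional\<close>
  define W where "W = space M \<inter> (\<Inter>j\<in>J. A j)"
  have A_sets: "A j \<in> sets M" if "j \<in> J" for j
    using indep A that unfolding cond_indep_sets_def by blast
  have W[measurable]: "W \<in> sets M"
  proof (cases "J = {}")
    case False
    then show ?thesis
      unfolding W_def using fin A_sets by (intro sets.Int sets.finite_INT) auto
  qed (simp add: W_def)
  have integrable_ind: "integrable M (indicator D :: 'w \<Rightarrow> real)" if "D \<in> sets M" for D
    using that by (intro integrable_const_bound[where B=1]) auto
  have cW: "AE w in M. real_cond_exp M (gen_by M S X) (indicator W) w = (\<Prod>j\<in>J. k j (X w))"
  proof (cases "J = {}")
    case True
    have "AE w in M. real_cond_exp M (gen_by M S X) (indicator W) w = 1"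
    proof (rule real_cond_exp_charact)
      fix B assume "B \<in> sets (gen_by M S X)"
      show "(\<integral>w\<in>B. indicator W w \<partial>M) = (\<integral>w\<in>B. 1 \<partial>M)"
        unfolding set_lebesgue_integral_def
        by (intro Bochner_Integration.integral_cong) (auto simp: W_def True)
    qed (auto intro: integrable_ind)
    then show ?thesis using True by simp
  next
    case False
    have "W = (\<Inter>j\<in>J. A j)"
      unfolding W_def using False sets.sets_into_space[OF A_sets] by blast
    then have "AE w in M. real_cond_exp M (gen_by M S X) (indicator W) w =
        (\<Prod>j\<in>J. cond_prob_of M (gen_by M S X) (A j) w)"
      using indep False fin A unfolding cond_indep_sets_def cond_prob_of_def by auto
    moreover have "AE w in M. \<forall>j\<in>J. cond_prob_of M (gen_by M S X) (A j) w = k j (X w)"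
      using fin k by (intro AE_finite_allI) auto
    ultimately show ?thesis by eventually_elim simp
  qed
  have prod_bounds: "0 \<le> (\<Prod>j\<in>J. k j x) \<and> (\<Prod>j\<in>J. k j x) \<le> 1" if "x \<in> space S" for x
    using k_bounds that by (auto intro!: prod_nonneg prod_le_1)
  have EX: "X -` E \<inter> space M \<in> sets (gen_by M S X)"
    using E by (auto simp: sets_gen_by[OF X])
  have "measure M ((X -` E \<inter> space M) \<inter> W) = (\<integral>w\<in>X -` E \<inter> space M. indicator W w \<partial>M)"
    unfolding set_lebesgue_integral_def
    by (simp flip: indicator_inter_arith)
  also have "\<dots> = (\<integral>w\<in>X -` E \<inter> space M. real_cond_exp M (gen_by M S X) (indicator W) w \<partial>M)"
    by (rule real_cond_exp_intA) (use EX in \<open>auto intro: integrable_ind\<close>)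
  also have "\<dots> = (\<integral>w. indicator E (X w) * (\<Prod>j\<in>J. k j (X w)) \<partial>M)"
    unfolding set_lebesgue_integral_def
  proof (rule integral_cong_AE)
    show "AE w in M. indicator (X -` E \<inter> space M) w *\<^sub>R real_cond_exp M (gen_by M S X) (indicator W) w =
      indicator E (X w) * (\<Prod>j\<in>J. k j (X w))"
      using cW AE_space by eventually_elim (auto simp: indicator_def)
  qed measurable
  finally have "emeasure M ((X -` E \<inter> space M) \<inter> W) =
      ennreal (\<integral>w. indicator E (X w) * (\<Prod>j\<in>J. k j (X w)) \<partial>M)"
    by (simp add: emeasure_eq_measure)
  also have "\<dots> = (\<integral>\<^sup>+ w. ennreal (indicator E (X w) * (\<Prod>j\<in>J. k j (X w))) \<partial>M)"
  proof (rule nn_integral_eq_integral[symmetric])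
    show "integrable M (\<lambda>w. indicator E (X w) * (\<Prod>j\<in>J. k j (X w)))"
      using prod_bounds measurable_space[OF X]
      by (intro integrable_const_bound[where B=1]) (auto simp: indicator_def)
    show "AE w in M. 0 \<le> indicator E (X w) * (\<Prod>j\<in>J. k j (X w))"
      using prod_bounds measurable_space[OF X] by (intro AE_I2) (auto simp: indicator_def)
  qed
  also have "\<dots> = (\<integral>\<^sup>+ w. indicator E (X w) * ennreal (\<Prod>j\<in>J. k j (X w)) \<partial>M)"
    by (intro nn_integral_cong) (auto simp: indicator_def)
  also have "\<dots> = (\<integral>\<^sup>+ x. indicator E x * ennreal (\<Prod>j\<in>J. k j x) \<partial>distr M S X)"
    by (subst nn_integral_distr) auto
  also have "(X -` E \<inter> space M) \<inter> W = (X -` E \<inter> space M) \<inter> (\<Inter>j\<in>J. A j)"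
    by (auto simp: W_def)
  finally show ?thesis .
qed

lemma Int_stable_rectangles:
  assumes "Int_stable \<A>" "Int_stable \<B>"
  shows "Int_stable {a \<times> b |a b. a \<in> \<A> \<and> b \<in> \<B>}"
proof (rule Int_stableI)
  fix x y
  assume "x \<in> {a \<times> b |a b. a \<in> \<A> \<and> b \<in> \<B>}" "y \<in> {a \<times> b |a b. a \<in> \<A> \<and> b \<in> \<B>}"
  then obtain a b c d where "x = a \<times> b" "y = c \<times> d" "a \<in> \<A>" "b \<in> \<B>" "c \<in> \<A>" "d \<in> \<B>"
    by blast
  moreover from this have "a \<inter> c \<in> \<A>" "b \<inter> d \<in> \<B>"
    using assms by (auto intro: Int_stableD)
  ultimately show "x \<inter> y \<in> {a \<times> b |a b. a \<in> \<A> \<and> b \<in> \<B>}"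
    by (auto simp: Times_Int_Times)
qed

lemma sets_pair_eq_sigma_sets:
  assumes "\<A> \<subseteq> Pow (space A)" "sets A = sigma_sets (space A) \<A>" "space A \<in> \<A>"
    and "\<B> \<subseteq> Pow (space B)" "sets B = sigma_sets (space B) \<B>" "space B \<in> \<B>"
  shows "sets (A \<Otimes>\<^sub>M B) = sigma_sets (space A \<times> space B) {a \<times> b |a b. a \<in> \<A> \<and> b \<in> \<B>}"
proof -
  have "sets (A \<Otimes>\<^sub>M B) = sets (sigma (space A \<times> space B) {a \<times> b |a b. a \<in> \<A> \<and> b \<in> \<B>})"
    by (rule sets_pair_eq[where Ca="{space A}" and Cb="{space B}"]) (use assms in auto)
  also have "\<dots> = sigma_sets (space A \<times> space B) {a \<times> b |a b. a \<in> \<A> \<and> b \<in> \<B>}"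
    using assms(1,4) by (intro sets_measure_of) blast
  finally show ?thesis .
qed

text \<open>
  Boxes form an intersection-stable generator that contains the whole space, so a finite measure
  on the product is determined by its values on them.
\<close>

lemma measure_eqI_box:
  fixes P Q :: "('x \<times> ('i \<Rightarrow> 'y) \<times> ('j \<Rightarrow> 'v)) measure"
  assumes fin: "finite I" "finite J"
    and P: "sets P = sets (\<mu> \<Otimes>\<^sub>M (PiM I \<alpha> \<Otimes>\<^sub>M PiM J \<beta>))"
    and Q: "sets Q = sets (\<mu> \<Otimes>\<^sub>M (PiM I \<alpha> \<Otimes>\<^sub>M PiM J \<beta>))"
    and finite: "emeasure P (space P) \<noteq> \<infinity>"
    and eq: "\<And>E A C. E \<in> sets \<mu> \<Longrightarrow> (\<And>i. i \<in> I \<Longrightarrow> A i \<in> sets (\<alpha> i)) \<Longrightarrow>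
      (\<And>j. j \<in> J \<Longrightarrow> C j \<in> sets (\<beta> j)) \<Longrightarrow>
      emeasure P (E \<times> PiE I A \<times> PiE J C) = emeasure Q (E \<times> PiE I A \<times> PiE J C)"
  shows "P = Q"
proof -
  let ?pi = "{a \<times> b |a b. a \<in> prod_algebra I \<alpha> \<and> b \<in> prod_algebra J \<beta>}"
  let ?E = "{E \<times> d |E d. E \<in> sets \<mu> \<and> d \<in> ?pi}"
  let ?\<Omega> = "space \<mu> \<times> space (PiM I \<alpha>) \<times> space (PiM J \<beta>)"
  have top: "space (PiM I \<alpha>) \<in> prod_algebra I \<alpha>" "space (PiM J \<beta>) \<in> prod_algebra J \<beta>"
    using fin by (auto simp: space_PiM intro!: prod_algebraI_finite)
  have algebra: "prod_algebra I \<alpha> \<subseteq> Pow (space (PiM I \<alpha>))" "prod_algebra J \<beta> \<subseteq> Pow (space (PiM J \<beta>))"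
    using prod_algebra_sets_into_space[of I \<alpha>] prod_algebra_sets_into_space[of J \<beta>]
    by (simp_all add: space_PiM)
  have pi_sets: "sets (PiM I \<alpha> \<Otimes>\<^sub>M PiM J \<beta>) = sigma_sets (space (PiM I \<alpha> \<Otimes>\<^sub>M PiM J \<beta>)) ?pi"
    unfolding space_pair_measure
    by (rule sets_pair_eq_sigma_sets[OF algebra(1) _ top(1) algebra(2) _ top(2)])
      (simp_all add: sets_PiM space_PiM)
  have pi_space: "?pi \<subseteq> Pow (space (PiM I \<alpha> \<Otimes>\<^sub>M PiM J \<beta>))"
    using algebra unfolding space_pair_measure by blast
  have pi_top: "space (PiM I \<alpha> \<Otimes>\<^sub>M PiM J \<beta>) \<in> ?pi"
    using top unfolding space_pair_measure by blast
  have E_sets: "sets (\<mu> \<Otimes>\<^sub>M (PiM I \<alpha> \<Otimes>\<^sub>M PiM J \<beta>)) = sigma_sets ?\<Omega> ?E"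
    using sets_pair_eq_sigma_sets[OF sets.space_closed sets.sigma_sets_eq[symmetric] sets.top pi_space pi_sets pi_top]
    by (simp add: space_pair_measure)
  have stable: "Int_stable ?pi"
    by (intro Int_stable_rectangles Int_stable_prod_algebra)
  show ?thesis
  proof (rule measure_eqI_generator_eq[where A="\<lambda>_. ?\<Omega>"])
    show "Int_stable ?E"
      by (rule Int_stable_rectangles[OF sets.Int_stable stable])
    show "?E \<subseteq> Pow ?\<Omega>"
      using sets.space_closed[of \<mu>] pi_space unfolding space_pair_measure by blast
    show "emeasure P U = emeasure Q U" if U: "U \<in> ?E" for U
    proof -
      from U obtain E a b where U: "U = E \<times> a \<times> b" "E \<in> sets \<mu>"
        "a \<in> prod_algebra I \<alpha>" "b \<in> prod_algebra J \<beta>" by blast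
      obtain A where A: "a = PiE I A" "A \<in> (\<Pi> i\<in>I. sets (\<alpha> i))"
        using U(3) by (rule prod_algebraE_all)
      obtain C where C: "b = PiE J C" "C \<in> (\<Pi> j\<in>J. sets (\<beta> j))"
        using U(4) by (rule prod_algebraE_all)
      show ?thesis unfolding U(1) A(1) C(1) using U(2) A(2) C(2) by (intro eq) auto
    qed
    show "range (\<lambda>_::nat. ?\<Omega>) \<subseteq> ?E" using top by blast
    show "emeasure P ?\<Omega> \<noteq> \<infinity>"
      using finite sets_eq_imp_space_eq[OF P] by (simp add: space_pair_measure)
  qed (use P Q E_sets in auto)
qed

text \<open>
  Both sides agree on a box \<open>E \<times> \<Pi> A \<times> \<Pi> C\<close>: for the joint law, the value is the integral over
  \<open>E\<close> of the product of the conditional probabilities of the factors, by conditional independence;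
  for the density, Tonelli's theorem splits the integral over the product space into the same
  integrals over the factors. The observations come as two families because they may take values
  in two different types.
\<close>

lemma joint_law_of_cond_indep:
  fixes M :: "'w measure" and \<mu> :: "'x measure" and \<alpha> :: "'y measure" and \<beta> :: "'v measure"
    and Y :: "'i \<Rightarrow> 'w \<Rightarrow> 'y" and V :: "'j \<Rightarrow> 'w \<Rightarrow> 'v"
  assumes M: "prob_space M" and fin: "finite I" "finite J"
    and \<mu>: "sigma_finite_measure \<mu>" and \<alpha>: "sigma_finite_measure \<alpha>" and \<beta>: "sigma_finite_measure \<beta>"
    and X[measurable]: "X \<in> measurable M \<mu>" and lawX: "distr M \<mu> X = density \<mu> p"
    and p[measurable]: "p \<in> borel_measurable \<mu>"
    and f[measurable]: "\<And>i. i \<in> I \<Longrightarrow> (\<lambda>(x, y). f i x y) \<in> borel_measurable (\<mu> \<Otimes>\<^sub>M \<alpha>)"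
    and g[measurable]: "\<And>j. j \<in> J \<Longrightarrow> (\<lambda>(x, y). g j x y) \<in> borel_measurable (\<mu> \<Otimes>\<^sub>M \<beta>)"
    and Y: "\<And>i. i \<in> I \<Longrightarrow> cond_distr M \<alpha> (Y i) \<mu> X (\<lambda>x. density \<alpha> (f i x))"
    and V: "\<And>j. j \<in> J \<Longrightarrow> cond_distr M \<beta> (V j) \<mu> X (\<lambda>x. density \<beta> (g j x))"
    and indep: "cond_indep_sets M (gen_by M \<mu> X)
      (case_sum (\<lambda>i. {Y i -` A \<inter> space M |A. A \<in> sets \<alpha>})
                (\<lambda>j. {V j -` A \<inter> space M |A. A \<in> sets \<beta>})) (I <+> J)"
  shows "distr M (\<mu> \<Otimes>\<^sub>M ((\<Pi>\<^sub>M i\<in>I. \<alpha>) \<Otimes>\<^sub>M (\<Pi>\<^sub>M j\<in>J. \<beta>)))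
      (\<lambda>w. (X w, (\<lambda>i\<in>I. Y i w, \<lambda>j\<in>J. V j w))) =
    density (\<mu> \<Otimes>\<^sub>M ((\<Pi>\<^sub>M i\<in>I. \<alpha>) \<Otimes>\<^sub>M (\<Pi>\<^sub>M j\<in>J. \<beta>)))
      (\<lambda>(x, ys, vs). p x * ((\<Prod>i\<in>I. f i x (ys i)) * (\<Prod>j\<in>J. g j x (vs j))))"
    (is "?P = ?Q")
proof (rule measure_eqI_box[OF fin])
  interpret prob_space M by (rule M)
  interpret \<alpha>: product_sigma_finite "\<lambda>_::'i. \<alpha>" by (simp add: product_sigma_finite_def \<alpha>)
  interpret \<beta>: product_sigma_finite "\<lambda>_::'j. \<beta>" by (simp add: product_sigma_finite_def \<beta>)
  interpret \<alpha>1: sigma_finite_measure \<alpha> by (rule \<alpha>)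
  interpret \<beta>1: sigma_finite_measure \<beta> by (rule \<beta>)
  let ?A = "\<Pi>\<^sub>M i\<in>I. \<alpha>" and ?B = "\<Pi>\<^sub>M j\<in>J. \<beta>"
  interpret A: sigma_finite_measure ?A by (rule \<alpha>.sigma_finite[OF fin(1)])
  interpret B: sigma_finite_measure ?B by (rule \<beta>.sigma_finite[OF fin(2)])
  interpret AB: pair_sigma_finite ?A ?B ..
  have Y_meas[measurable]: "Y i \<in> measurable M \<alpha>" if "i \<in> I" for i
    using Y[OF that] by (simp add: cond_distr_def)
  have V_meas[measurable]: "V j \<in> measurable M \<beta>" if "j \<in> J" for j
    using V[OF that] by (simp add: cond_distr_def)
  have obs[measurable]: "(\<lambda>w. (X w, (\<lambda>i\<in>I. Y i w, \<lambda>j\<in>J. V j w))) \<in>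
      measurable M (\<mu> \<Otimes>\<^sub>M (?A \<Otimes>\<^sub>M ?B))"
    by (intro measurable_Pair measurable_restrict X Y_meas V_meas)
  show "sets ?P = sets (\<mu> \<Otimes>\<^sub>M (?A \<Otimes>\<^sub>M ?B))" "sets ?Q = sets (\<mu> \<Otimes>\<^sub>M (?A \<Otimes>\<^sub>M ?B))"
    by simp_all
  show "emeasure ?P (space ?P) \<noteq> \<infinity>"
    using prob_space.emeasure_space_1[OF prob_space_distr[OF obs]] by simp
  fix E :: "'x set" and A :: "'i \<Rightarrow> 'y set" and C :: "'j \<Rightarrow> 'v set"
  assume E[measurable]: "E \<in> sets \<mu>" and A[measurable]: "\<And>i. i \<in> I \<Longrightarrow> A i \<in> sets \<alpha>"
    and C[measurable]: "\<And>j. j \<in> J \<Longrightarrow> C j \<in> sets \<beta>"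
  let ?U = "E \<times> PiE I A \<times> PiE J C"
  define Ev where "Ev = case_sum (\<lambda>i. Y i -` A i \<inter> space M) (\<lambda>j. V j -` C j \<inter> space M)"
  define k where "k = case_sum (\<lambda>i x. measure (density \<alpha> (f i x)) (A i))
    (\<lambda>j x. measure (density \<beta> (g j x)) (C j))"
  have U[measurable]: "?U \<in> sets (\<mu> \<Otimes>\<^sub>M (?A \<Otimes>\<^sub>M ?B))"
    by (intro pair_measureI sets_PiM_I_finite fin A C E) auto
  have probY: "prob_space (density \<alpha> (f i x))" if "i \<in> I" "x \<in> space \<mu>" for i x
    using Y[OF that(1)] measurable_space[of _ \<mu> "prob_algebra \<alpha>" x] that(2)
    by (fastforce simp: cond_distr_def space_prob_algebra)
  have probV: "prob_space (density \<beta> (g j x))" if "j \<in> J" "x \<in> space \<mu>" for j x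
    using V[OF that(1)] measurable_space[of _ \<mu> "prob_algebra \<beta>" x] that(2)
    by (fastforce simp: cond_distr_def space_prob_algebra)
  have kY: "ennreal (k (Inl i) x) = (\<integral>\<^sup>+ y. f i x y * indicator (A i) y \<partial>\<alpha>)"
    if "i \<in> I" "x \<in> space \<mu>" for i x
  proof -
    interpret K: prob_space "density \<alpha> (f i x)" by (rule probY[OF that])
    have "f i x \<in> borel_measurable \<alpha>"
      using measurable_compose[OF measurable_Pair1'[OF that(2)] f[OF that(1)]] by simp
    then show ?thesis
      using A[OF that(1)] by (simp add: k_def K.emeasure_eq_measure[symmetric] emeasure_density)
  qed
  have kV: "ennreal (k (Inr j) x) = (\<integral>\<^sup>+ y. g j x y * indicator (C j) y \<partial>\<beta>)"
    if "j \<in> J" "x \<in> space \<mu>" for j x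
  proof -
    interpret K: prob_space "density \<beta> (g j x)" by (rule probV[OF that])
    have "g j x \<in> borel_measurable \<beta>"
      using measurable_compose[OF measurable_Pair1'[OF that(2)] g[OF that(1)]] by simp
    then show ?thesis
      using C[OF that(1)] by (simp add: k_def K.emeasure_eq_measure[symmetric] emeasure_density)
  qed
  have k_meas[measurable]: "k s \<in> borel_measurable \<mu>" if "s \<in> I <+> J" for s
    using that
  proof (elim PlusE)
    fix i assume i: "i \<in> I" "s = Inl i"
    show ?thesis
      unfolding k_def i(2) sum.case
      by (rule measurable_compose[OF _ measurable_measure_prob_algebra[OF A[OF i(1)]]])
        (use Y[OF i(1)] in \<open>simp add: cond_distr_def\<close>)
  next
    fix j assume j: "j \<in> J" "s = Inr j"
    show ?thesis
      unfolding k_def j(2) sum.case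
      by (rule measurable_compose[OF _ measurable_measure_prob_algebra[OF C[OF j(1)]]])
        (use V[OF j(1)] in \<open>simp add: cond_distr_def\<close>)
  qed
  have "emeasure ?P ?U = emeasure M ((X -` E \<inter> space M) \<inter> (\<Inter>s\<in>I <+> J. Ev s))"
    by (subst emeasure_distr) (auto simp: Ev_def PiE_iff Plus_def ball_Un intro!: arg_cong[where f="emeasure M"])
  also have "\<dots> = (\<integral>\<^sup>+ x. indicator E x * ennreal (\<Prod>s\<in>I <+> J. k s x) \<partial>distr M \<mu> X)"
  proof (rule emeasure_cond_indep_inter[OF M X indep])
    show "0 \<le> k s x \<and> k s x \<le> 1" if "s \<in> I <+> J" "x \<in> space \<mu>" for s x
      using that probY probV by (auto simp: k_def prob_space.prob_le_1)
    show "AE w in M. cond_prob_of M (gen_by M \<mu> X) (Ev s) w = k s (X w)" if "s \<in> I <+> J" for s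
      using that Y V A C by (auto simp: k_def Ev_def cond_distr_def)
    show "Ev s \<in> (case s of Inl i \<Rightarrow> {Y i -` A \<inter> space M |A. A \<in> sets \<alpha>}
        | Inr j \<Rightarrow> {V j -` A \<inter> space M |A. A \<in> sets \<beta>})" if "s \<in> I <+> J" for s
      using that by (elim PlusE) (auto simp: Ev_def intro!: A C)
  qed (use fin in \<open>auto intro: k_meas E\<close>)
  also have "\<dots> = (\<integral>\<^sup>+ x. p x * (indicator E x * ennreal (\<Prod>s\<in>I <+> J. k s x)) \<partial>\<mu>)"
    unfolding lawX by (subst nn_integral_density) auto
  also have "\<dots> = (\<integral>\<^sup>+ x. (\<integral>\<^sup>+ v. (case v of (ys, vs) \<Rightarrow> p x * ((\<Prod>i\<in>I. f i x (ys i)) * (\<Prod>j\<in>J. g j x (vs j)))) *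
      indicator ?U (x, v) \<partial>(?A \<Otimes>\<^sub>M ?B)) \<partial>\<mu>)"
  proof (rule nn_integral_cong)
    fix x assume x: "x \<in> space \<mu>"
    have fx[measurable]: "f i x \<in> borel_measurable \<alpha>" if "i \<in> I" for i
      using measurable_compose[OF measurable_Pair1'[OF x] f[OF that]] by simp
    have gx[measurable]: "g j x \<in> borel_measurable \<beta>" if "j \<in> J" for j
      using measurable_compose[OF measurable_Pair1'[OF x] g[OF that]] by simp
    have indA: "indicator (PiE I A) ys = (\<Prod>i\<in>I. indicator (A i) (ys i) :: ennreal)"
      if "ys \<in> space ?A" for ys
      using that fin by (auto simp: indicator_def space_PiM PiE_iff extensional_def prod_zero_iff)
    have indC: "indicator (PiE J C) vs = (\<Prod>j\<in>J. indicator (C j) (vs j) :: ennreal)"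
      if "vs \<in> space ?B" for vs
      using that fin by (auto simp: indicator_def space_PiM PiE_iff extensional_def prod_zero_iff)
    define fA where "fA ys = (\<Prod>i\<in>I. f i x (ys i) * indicator (A i) (ys i))" for ys
    define gC where "gC vs = (\<Prod>j\<in>J. g j x (vs j) * indicator (C j) (vs j))" for vs
    have [measurable]: "fA \<in> borel_measurable ?A" "gC \<in> borel_measurable ?B"
      unfolding fA_def gC_def by measurable
    have "(\<integral>\<^sup>+ v. (case v of (ys, vs) \<Rightarrow> p x * ((\<Prod>i\<in>I. f i x (ys i)) * (\<Prod>j\<in>J. g j x (vs j)))) *
        indicator ?U (x, v) \<partial>(?A \<Otimes>\<^sub>M ?B)) =
        (\<integral>\<^sup>+ v. (p x * indicator E x) * (fA (fst v) * gC (snd v)) \<partial>(?A \<Otimes>\<^sub>M ?B))"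
    proof (rule nn_integral_cong)
      fix v assume "v \<in> space (?A \<Otimes>\<^sub>M ?B)"
      then obtain ys vs where v: "v = (ys, vs)" "ys \<in> space ?A" "vs \<in> space ?B"
        by (auto simp: space_pair_measure)
      show "(case v of (ys, vs) \<Rightarrow> p x * ((\<Prod>i\<in>I. f i x (ys i)) * (\<Prod>j\<in>J. g j x (vs j)))) * indicator ?U (x, v) =
        (p x * indicator E x) * (fA (fst v) * gC (snd v))"
        unfolding v(1) fA_def gC_def prod.distrib
        by (simp add: indicator_times indA[OF v(2)] indC[OF v(3)] mult_ac)
    qed
    also have "\<dots> = (p x * indicator E x) * (integral\<^sup>N ?A fA * integral\<^sup>N ?B gC)"
      by (simp add: nn_integral_cmult B.nn_integral_fst[symmetric] nn_integral_multc)
    also have "integral\<^sup>N ?A fA = (\<Prod>i\<in>I. ennreal (k (Inl i) x))"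
      unfolding fA_def using fin x kY A by (subst \<alpha>.product_nn_integral_prod) auto
    also have "integral\<^sup>N ?B gC = (\<Prod>j\<in>J. ennreal (k (Inr j) x))"
      unfolding gC_def using fin x kV C by (subst \<beta>.product_nn_integral_prod) auto
    also have "(\<Prod>i\<in>I. ennreal (k (Inl i) x)) * (\<Prod>j\<in>J. ennreal (k (Inr j) x)) =
        ennreal (\<Prod>s\<in>I <+> J. k s x)"
      by (simp add: prod.Plus fin prod_ennreal ennreal_mult prod_nonneg k_def)
    finally show "p x * (indicator E x * ennreal (\<Prod>s\<in>I <+> J. k s x)) =
        (\<integral>\<^sup>+ v. (case v of (ys, vs) \<Rightarrow> p x * ((\<Prod>i\<in>I. f i x (ys i)) * (\<Prod>j\<in>J. g j x (vs j)))) *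
          indicator ?U (x, v) \<partial>(?A \<Otimes>\<^sub>M ?B))"
      by (simp add: mult_ac)
  qed
  also have "\<dots> = emeasure ?Q ?U"
  proof -
    have [measurable]: "(\<lambda>u. f i (fst u) (fst (snd u) i)) \<in> borel_measurable (\<mu> \<Otimes>\<^sub>M (?A \<Otimes>\<^sub>M ?B))"
      if i: "i \<in> I" for i
    proof -
      have pair[measurable]: "(\<lambda>u. (fst u, fst (snd u) i)) \<in> measurable (\<mu> \<Otimes>\<^sub>M (?A \<Otimes>\<^sub>M ?B)) (\<mu> \<Otimes>\<^sub>M \<alpha>)"
        using i by measurable
      show ?thesis using measurable_compose[OF pair f[OF i]] by simp
    qed
    have [measurable]: "(\<lambda>u. g j (fst u) (snd (snd u) j)) \<in> borel_measurable (\<mu> \<Otimes>\<^sub>M (?A \<Otimes>\<^sub>M ?B))"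
      if j: "j \<in> J" for j
    proof -
      have pair[measurable]: "(\<lambda>u. (fst u, snd (snd u) j)) \<in> measurable (\<mu> \<Otimes>\<^sub>M (?A \<Otimes>\<^sub>M ?B)) (\<mu> \<Otimes>\<^sub>M \<beta>)"
        using j by measurable
      show ?thesis using measurable_compose[OF pair g[OF j]] by simp
    qed
    have [measurable]: "(\<lambda>(x, ys, vs). p x * ((\<Prod>i\<in>I. f i x (ys i)) * (\<Prod>j\<in>J. g j x (vs j))))
        \<in> borel_measurable (\<mu> \<Otimes>\<^sub>M (?A \<Otimes>\<^sub>M ?B))"
      unfolding case_prod_beta by measurable
    show ?thesis
      by (subst emeasure_density) (auto simp: sigma_finite_measure.nn_integral_fst[OF AB.sigma_finite_measure_axioms, symmetric])
  qed
  finally show "emeasure ?P ?U = emeasure ?Q ?U" .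
qed

section \<open>Bayes' rule for densities\<close>

text \<open>
  Integrating out the first component shows that \<open>m\<close> is the density of \<open>Y\<close>, because every \<open>k y\<close>
  integrates to one. Hence integrating the kernel over \<open>Y \<in> C\<close> reproduces the probability of
  \<open>X \<in> A\<close> and \<open>Y \<in> C\<close>, which characterises the conditional probability.
\<close>

lemma cond_distr_of_joint_density:
  assumes M: "prob_space M" and \<mu>: "sigma_finite_measure \<mu>" and \<tau>: "sigma_finite_measure \<tau>"
    and X[measurable]: "X \<in> measurable M \<mu>" and Y[measurable]: "Y \<in> measurable M \<tau>"
    and K[measurable]: "(\<lambda>y. density \<mu> (k y)) \<in> measurable \<tau> (prob_algebra \<mu>)"
    and k[measurable]: "(\<lambda>(x, y). k y x) \<in> borel_measurable (\<mu> \<Otimes>\<^sub>M \<tau>)"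
    and m[measurable]: "m \<in> borel_measurable \<tau>"
    and joint: "distr M (\<mu> \<Otimes>\<^sub>M \<tau>) (\<lambda>w. (X w, Y w)) = density (\<mu> \<Otimes>\<^sub>M \<tau>) (\<lambda>(x, y). k y x * m y)"
  shows "cond_distr M \<mu> X \<tau> Y (\<lambda>y. density \<mu> (k y))"
  unfolding cond_distr_def
proof (intro conjI ballI X Y K)
  fix A assume A[measurable]: "A \<in> sets \<mu>"
  interpret prob_space M by (rule M)
  interpret finite_measure_subalgebra M "gen_by M \<tau> Y"
    by unfold_locales (rule subalgebra_gen_by[OF Y])
  interpret \<mu>: sigma_finite_measure \<mu> by (rule \<mu>)
  interpret \<tau>: sigma_finite_measure \<tau> by (rule \<tau>)
  interpret P: pair_sigma_finite \<mu> \<tau> ..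
  let ?K = "\<lambda>y. density \<mu> (k y)"
  have Kprob: "prob_space (?K y)" if "y \<in> space \<tau>" for y
    using measurable_space[OF K that] by (simp add: space_prob_algebra)
  have joint_emeasure: "emeasure M (X -` D \<inter> Y -` C \<inter> space M) =
      (\<integral>\<^sup>+ y. m y * (indicator C y * emeasure (?K y) D) \<partial>\<tau>)"
    if [measurable]: "D \<in> sets \<mu>" "C \<in> sets \<tau>" for C D
  proof -
    have "emeasure M (X -` D \<inter> Y -` C \<inter> space M) =
        emeasure (distr M (\<mu> \<Otimes>\<^sub>M \<tau>) (\<lambda>w. (X w, Y w))) (D \<times> C)"
      by (subst emeasure_distr) (auto intro!: arg_cong[where f="emeasure M"])
    also have "\<dots> = (\<integral>\<^sup>+ u. (case u of (x, y) \<Rightarrow> k y x * m y) * indicator (D \<times> C) u \<partial>(\<mu> \<Otimes>\<^sub>M \<tau>))"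
      unfolding joint by (subst emeasure_density) auto
    also have "\<dots> = (\<integral>\<^sup>+ y. (\<integral>\<^sup>+ x. k y x * m y * indicator (D \<times> C) (x, y) \<partial>\<mu>) \<partial>\<tau>)"
      by (subst P.nn_integral_snd[symmetric]) auto
    also have "\<dots> = (\<integral>\<^sup>+ y. m y * (indicator C y * emeasure (?K y) D) \<partial>\<tau>)"
    proof (rule nn_integral_cong)
      fix y assume y: "y \<in> space \<tau>"
      have [measurable]: "k y \<in> borel_measurable \<mu>"
        using measurable_compose[OF measurable_Pair2'[OF y] k] by simp
      have "(\<integral>\<^sup>+ x. k y x * m y * indicator (D \<times> C) (x, y) \<partial>\<mu>) =
          (\<integral>\<^sup>+ x. (m y * indicator C y) * (k y x * indicator D x) \<partial>\<mu>)"
        by (intro nn_integral_cong) (simp add: indicator_times mult_ac)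
      also have "\<dots> = m y * (indicator C y * emeasure (?K y) D)"
        by (subst nn_integral_cmult) (auto simp: emeasure_density mult_ac)
      finally show "(\<integral>\<^sup>+ x. k y x * m y * indicator (D \<times> C) (x, y) \<partial>\<mu>) =
          m y * (indicator C y * emeasure (?K y) D)" .
    qed
    finally show ?thesis .
  qed
  have lawY: "distr M \<tau> Y = density \<tau> m"
  proof (rule measure_eqI)
    fix C assume "C \<in> sets (distr M \<tau> Y)"
    then have C[measurable]: "C \<in> sets \<tau>" by simp
    have "emeasure (distr M \<tau> Y) C = emeasure M (X -` space \<mu> \<inter> Y -` C \<inter> space M)"
      using measurable_space[OF X]
      by (subst emeasure_distr) (auto intro!: arg_cong[where f="emeasure M"])
    also have "\<dots> = (\<integral>\<^sup>+ y. m y * (indicator C y * emeasure (?K y) (space \<mu>)) \<partial>\<tau>)"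
      by (rule joint_emeasure) auto
    also have "\<dots> = (\<integral>\<^sup>+ y. m y * indicator C y \<partial>\<tau>)"
      using prob_space.emeasure_space_1[OF Kprob] by (intro nn_integral_cong) simp
    also have "\<dots> = emeasure (density \<tau> m) C"
      by (simp add: emeasure_density)
    finally show "emeasure (distr M \<tau> Y) C = emeasure (density \<tau> m) C" .
  qed simp
  have KA[measurable]: "(\<lambda>y. measure (?K y) A) \<in> borel_measurable \<tau>"
    by (rule measurable_compose[OF K measurable_measure_prob_algebra]) fact
  have KA_bounds: "0 \<le> measure (?K y) A \<and> measure (?K y) A \<le> 1" if "y \<in> space \<tau>" for y
    using prob_space.prob_le_1[OF Kprob[OF that]] by simp
  have KY: "(\<lambda>w. measure (?K (Y w)) A) \<in> borel_measurable (gen_by M \<tau> Y)"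
    unfolding gen_by_def using measurable_space[OF Y]
    by (intro measurable_compose[OF measurable_vimage_algebra1 KA]) auto
  have int: "integrable M (\<lambda>w. measure (?K (Y w)) A)"
    using KA_bounds measurable_space[OF Y] by (intro integrable_const_bound[where B=1]) auto
  show "AE w in M. cond_prob_of M (gen_by M \<tau> Y) (X -` A \<inter> space M) w = measure (?K (Y w)) A"
    unfolding cond_prob_of_def
  proof (rule real_cond_exp_charact)
    fix B assume "B \<in> sets (gen_by M \<tau> Y)"
    then obtain C where C[measurable]: "C \<in> sets \<tau>" and B: "B = Y -` C \<inter> space M"
      by (auto simp: sets_gen_by[OF Y])
    have "ennreal (\<integral>w\<in>B. indicator (X -` A \<inter> space M) w \<partial>M) = emeasure M (X -` A \<inter> Y -` C \<inter> space M)"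
    proof -
      have "(\<integral>w\<in>B. indicator (X -` A \<inter> space M) w \<partial>M) = (\<integral>w. indicat_real (X -` A \<inter> Y -` C \<inter> space M) w \<partial>M)"
        unfolding set_lebesgue_integral_def B
        by (intro Bochner_Integration.integral_cong) (auto simp: indicator_def)
      then show ?thesis by (simp add: emeasure_eq_measure Int_assoc)
    qed
    also have "\<dots> = (\<integral>\<^sup>+ y. indicator C y * emeasure (?K y) A \<partial>distr M \<tau> Y)"
    proof -
      have [measurable]: "(\<lambda>y. emeasure (?K y) A) \<in> borel_measurable \<tau>"
        using measurable_compose[OF measurable_prob_algebraD[OF K] measurable_emeasure_subprob_algebra[OF A]] .
      show ?thesis unfolding lawY by (subst nn_integral_density) (auto simp: joint_emeasure)
    qed
    also have "\<dots> = (\<integral>\<^sup>+ y. ennreal (indicator C y * measure (?K y) A) \<partial>distr M \<tau> Y)"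
    proof (rule nn_integral_cong)
      fix y assume "y \<in> space (distr M \<tau> Y)"
      then interpret Ky: prob_space "?K y" by (intro Kprob) simp
      show "indicator C y * emeasure (?K y) A = ennreal (indicator C y * measure (?K y) A)"
        by (auto simp: indicator_def Ky.emeasure_eq_measure)
    qed
    also have "\<dots> = (\<integral>\<^sup>+ w. ennreal (indicator C (Y w) * measure (?K (Y w)) A) \<partial>M)"
      by (subst nn_integral_distr) auto
    also have "\<dots> = ennreal (\<integral>w. indicator C (Y w) * measure (?K (Y w)) A \<partial>M)"
      using KA_bounds measurable_space[OF Y]
      by (intro nn_integral_eq_integral integrable_const_bound[where B=1] AE_I2)
        (auto simp: indicator_def)
    also have "(\<integral>w. indicator C (Y w) * measure (?K (Y w)) A \<partial>M) = (\<integral>w\<in>B. measure (?K (Y w)) A \<partial>M)"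
      unfolding set_lebesgue_integral_def B
      by (intro Bochner_Integration.integral_cong) (auto simp: indicator_def)
    finally show "(\<integral>w\<in>B. indicator (X -` A \<inter> space M) w \<partial>M) = (\<integral>w\<in>B. measure (?K (Y w)) A \<partial>M)"
      by (subst (asm) ennreal_inj)
        (auto simp: set_lebesgue_integral_def intro!: integral_nonneg_AE AE_I2)
  next
    show "integrable M (indicat_real (X -` A \<inter> space M))"
      by (intro integrable_const_bound[where B=1]) auto
  qed (use int KY in auto)
qed

section \<open>The matrix Fisher family\<close>

lemma trace_transpose_mult: "trace (transpose F ** R) = F \<bullet> R"
  for F R :: "real^'n^'n"
  unfolding trace_def matrix_matrix_mult_def transpose_def inner_vec_def
  by (simp, subst sum.swap) simp

lemma inner_matrix_mult_left: "(r ** F) \<bullet> y = r \<bullet> (y ** transpose F)"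
  for F r y :: "real^'n^'n"
  by (simp flip: trace_transpose_mult
      add: matrix_transpose_mul matrix_mul_assoc[symmetric] trace_mul_sym[of "transpose F"])

lemma inner_outer_prod: "r \<bullet> outer_prod u v = u \<bullet> (r *v v)"
  unfolding outer_prod_def inner_vec_def matrix_matrix_mult_def matrix_vector_mult_def
    columnvector_def rowvector_def
  by (simp add: sum_distrib_left mult_ac)

lemma trace_attitude: "trace (transpose F ** transpose r ** y) = r \<bullet> (y ** transpose F)"
  for F r y :: "real^'n^'n"
  by (metis inner_matrix_mult_left matrix_transpose_mul trace_transpose_mult)

lemma inner_direction: "u \<bullet> (transpose B *v (r *v y)) = r \<bullet> outer_prod (B *v u) y"
  unfolding inner_outer_prod
  by (subst (1 2) inner_commute) (simp add: transpose_matrix_vector dot_lmul_matrix)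

lemma norm_SO3:
  assumes "R \<in> SO3"
  shows "norm R = sqrt 3"
proof -
  have "R \<bullet> R = 3"
    using assms by (simp add: SO3_def trace_transpose_mult[symmetric] trace_I)
  then show ?thesis by (simp add: norm_eq_sqrt_inner)
qed

context
  fixes haar :: "(real^3^3) measure"
  assumes haar: "normalized_haar_SO3 haar"
begin

lemma sets_haar [measurable_cong]: "sets haar = sets (restrict_space borel SO3)"
  using haar by (simp add: normalized_haar_SO3_def)

lemma space_haar: "space haar = SO3"
  using sets_eq_imp_space_eq[OF sets_haar] by (simp add: space_restrict_space)

lemma prob_space_haar: "prob_space haar"
  using haar by (intro prob_spaceI) (simp add: space_haar normalized_haar_SO3_def)

lemma borel_haar [measurable]: "(\<lambda>R. R) \<in> borel_measurable haar"
  by (subst measurable_cong_sets[OF sets_haar refl]) (auto intro: measurable_restrict_space1)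

text \<open>
  Rotation matrices lie on a sphere in matrix space. This bounds the exponential weight from above
  and, applied to \<open>- F\<close>, away from zero, so the normalizing constant is finite and positive.
\<close>

lemma inner_SO3_le:
  assumes "R \<in> SO3"
  shows "F \<bullet> R \<le> norm F * sqrt 3"
  using norm_cauchy_schwarz[of F R] norm_SO3[OF assms] by simp

lemma integrable_fisher_weight: "integrable haar (\<lambda>R. exp (F \<bullet> R))"
proof -
  interpret prob_space haar by (rule prob_space_haar)
  show ?thesis
    by (rule integrable_const_bound[where B="exp (norm F * sqrt 3)"])
      (auto simp: space_haar intro!: AE_I2 inner_SO3_le)
qed

lemma fisher_const_pos: "0 < fisher_const haar F"
proof -
  interpret prob_space haar by (rule prob_space_haar)
  have "exp (- (norm F * sqrt 3)) \<le> (\<integral>R. exp (F \<bullet> R) \<partial>haar)"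
  proof (rule integral_ge_const[OF integrable_fisher_weight], rule AE_I2)
    fix R assume "R \<in> space haar"
    then show "exp (- (norm F * sqrt 3)) \<le> exp (F \<bullet> R)"
      using inner_SO3_le[of R "- F"] by (simp add: space_haar)
  qed
  then have "0 < (\<integral>R. exp (F \<bullet> R) \<partial>haar)"
    by (rule less_le_trans[OF exp_gt_zero])
  then show ?thesis by (simp add: fisher_const_def trace_transpose_mult)
qed

lemma fisher_const_measurable [measurable]: "fisher_const haar \<in> borel_measurable borel"
proof -
  interpret prob_space haar by (rule prob_space_haar)
  show ?thesis
    unfolding fisher_const_def trace_transpose_mult by measurable
qed

lemma sets_matrix_fisher: "sets (matrix_fisher haar F) = sets haar"
  by (simp add: matrix_fisher_def)

lemma prob_space_matrix_fisher: "prob_space (matrix_fisher haar F)"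
proof (rule prob_spaceI)
  have [measurable]: "fisher_density haar F \<in> borel_measurable haar"
    unfolding fisher_density_def trace_transpose_mult by measurable
  have "emeasure (matrix_fisher haar F) (space haar) = (\<integral>\<^sup>+ R. ennreal (fisher_density haar F R) \<partial>haar)"
    unfolding matrix_fisher_def
    by (subst emeasure_density) (auto intro!: nn_integral_cong)
  also have "\<dots> = ennreal (\<integral>R. fisher_density haar F R \<partial>haar)"
    using integrable_fisher_weight[of F] fisher_const_pos[of F]
    by (intro nn_integral_eq_integral)
      (auto simp: fisher_density_def trace_transpose_mult less_imp_le)
  also have "(\<integral>R. fisher_density haar F R \<partial>haar) = 1"
    using fisher_const_pos[of F] by (simp add: fisher_density_def fisher_const_def)
  finally show "emeasure (matrix_fisher haar F) (space (matrix_fisher haar F)) = 1"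
    by (simp add: matrix_fisher_def)
qed

lemma matrix_fisher_kernel [measurable]: "matrix_fisher haar \<in> measurable borel (prob_algebra haar)"
proof (intro measurable_prob_algebraI measurable_subprob_algebra)
  interpret prob_space haar by (rule prob_space_haar)
  fix A assume [measurable]: "A \<in> sets haar"
  have [measurable]: "fisher_density haar F \<in> borel_measurable haar" for F
    unfolding fisher_density_def trace_transpose_mult by measurable
  have [measurable]: "(\<lambda>(F, R). fisher_density haar F R) \<in> borel_measurable (borel \<Otimes>\<^sub>M haar)"
    unfolding fisher_density_def trace_transpose_mult by measurable
  show "(\<lambda>F. emeasure (matrix_fisher haar F) A) \<in> borel_measurable borel"
    unfolding matrix_fisher_def by (simp add: emeasure_density)
qed (simp_all add: prob_space_matrix_fisher prob_space_imp_subprob_space sets_matrix_fisher)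

end

section \<open>The posterior\<close>

lemma finite_measure_area_S2: "finite_measure area_S2"
proof -
  let ?U = "uniform_measure lborel (ball 0 1) :: (real^3) measure"
  have nz: "emeasure lborel (ball (0::real^3) 1) \<noteq> 0"
    using content_ball_pos[of 1 "0::real^3"] by (auto simp: measure_def)
  have "emeasure lborel (ball (0::real^3) 1) \<noteq> \<infinity>"
    using emeasure_bounded_finite[of "ball (0::real^3) 1"] by simp
  then interpret U: prob_space ?U
    by (rule prob_space_uniform_measure[OF nz])
  have "finite_measure (restrict_space ?U (ball 0 1 - {0}))"
    by (rule finite_measure_restrict_space) (auto intro: U.finite_measure_axioms)
  moreover have "sgn \<in> measurable (restrict_space ?U (ball 0 1 - {0})) (restrict_space borel S2)"
    by (intro measurable_restrict_space3) (auto simp: norm_sgn)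
  ultimately interpret S: finite_measure uniform_S2
    unfolding uniform_S2_def by (rule finite_measure.finite_measure_distr)
  show ?thesis
    by (rule finite_measureI)
      (simp add: area_S2_def space_scale_measure ennreal_mult_eq_top_iff)
qed

lemma borel_area_S2 [measurable]: "(\<lambda>x. x) \<in> borel_measurable area_S2"
proof -
  have "sets area_S2 = sets (restrict_space borel S2)"
    by (simp add: area_S2_def uniform_S2_def)
  then show ?thesis
    by (subst measurable_cong_sets[OF _ refl]) (auto intro: measurable_restrict_space1)
qed

theorem mainTheorem8:
  fixes haar :: "(real^3^3) measure"
    and M :: "'w measure"
    and R :: "'w \<Rightarrow> real^3^3"
    and NZ Nz :: nat
    and Z :: "nat \<Rightarrow> 'w \<Rightarrow> real^3^3"
    and z :: "nat \<Rightarrow> 'w \<Rightarrow> real^3"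
    and F :: "real^3^3"
    and FZ :: "nat \<Rightarrow> real^3^3"
    and a :: "nat \<Rightarrow> real^3"
    and b :: "nat \<Rightarrow> real"
    and B :: "nat \<Rightarrow> real^3^3"
  assumes haar: "normalized_haar_SO3 haar"
    and M: "prob_space M"
    and a: "\<And>j. j \<in> {1..Nz} \<Longrightarrow> a j \<in> S2"
    and b: "\<And>j. j \<in> {1..Nz} \<Longrightarrow> b j > 0"
    and B: "\<And>j. j \<in> {1..Nz} \<Longrightarrow> B j \<in> SO3"
    and prior: "R \<in> measurable M haar" "distr M haar R = matrix_fisher haar F"
    and attitude: "\<And>i. i \<in> {1..NZ} \<Longrightarrow>
      cond_distr M haar (Z i) haar R
        (\<lambda>r. density haar (\<lambda>y. ennreal
           (1 / fisher_const haar (FZ i) * exp (trace (transpose (FZ i) ** transpose r ** y)))))"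
    and direction: "\<And>j. j \<in> {1..Nz} \<Longrightarrow>
      cond_distr M area_S2 (z j) haar R
        (\<lambda>r. density area_S2 (\<lambda>y. ennreal
           (b j / (4 * pi * sinh (b j)) * exp (b j * (a j \<bullet> (transpose (B j) *v (r *v y)))))))"
    and indep: "cond_indep_sets M (gen_by M haar R)
      (case_sum (\<lambda>i. {Z i -` A \<inter> space M |A. A \<in> sets haar})
                (\<lambda>j. {z j -` A \<inter> space M |A. A \<in> sets area_S2}))
      ({1..NZ} <+> {1..Nz})"
  shows "cond_distr M haar R
      ((\<Pi>\<^sub>M i\<in>{1..NZ}. haar) \<Otimes>\<^sub>M (\<Pi>\<^sub>M j\<in>{1..Nz}. area_S2))
      (\<lambda>w. (\<lambda>i\<in>{1..NZ}. Z i w, \<lambda>j\<in>{1..Nz}. z j w))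
      (\<lambda>(Zs, zs). matrix_fisher haar
         (F + (\<Sum>i=1..NZ. Zs i ** transpose (FZ i))
            + (\<Sum>j=1..Nz. b j *\<^sub>R outer_prod (B j *v a j) (zs j))))"
proof -
  interpret haar: prob_space haar by (rule prob_space_haar[OF haar])
  interpret area: finite_measure area_S2 by (rule finite_measure_area_S2)
  note [measurable] = borel_haar[OF haar] fisher_const_measurable[OF haar] prior(1)
  interpret PA: product_sigma_finite "\<lambda>_::nat. haar"
    by (simp add: product_sigma_finite_def haar.sigma_finite_measure_axioms)
  interpret PB: product_sigma_finite "\<lambda>_::nat. area_S2"
    by (simp add: product_sigma_finite_def area.sigma_finite_measure_axioms)
  let ?A = "\<Pi>\<^sub>M i\<in>{1..NZ}. haar" and ?B = "\<Pi>\<^sub>M j\<in>{1..Nz}. area_S2"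
  let ?T = "?A \<Otimes>\<^sub>M ?B"
  interpret AB: pair_sigma_finite ?A ?B
    by (intro pair_sigma_finite.intro PA.sigma_finite PB.sigma_finite) auto
  define obs where "obs w = (\<lambda>i\<in>{1..NZ}. Z i w, \<lambda>j\<in>{1..Nz}. z j w)" for w
  define f where "f i r y = ennreal
    (1 / fisher_const haar (FZ i) * exp (trace (transpose (FZ i) ** transpose r ** y)))" for i and r y :: "real^3^3"
  define g where "g j r y = ennreal
    (b j / (4 * pi * sinh (b j)) * exp (b j * (a j \<bullet> (transpose (B j) *v (r *v y)))))" for j and r :: "real^3^3" and y
  \<comment> \<open>the posterior parameter and the density of the observations at a measurement record \<open>v\<close>\<close>
  define \<Phi> where "\<Phi> v = F + (\<Sum>i=1..NZ. fst v i ** transpose (FZ i))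
    + (\<Sum>j=1..Nz. b j *\<^sub>R outer_prod (B j *v a j) (snd v j))" for v
  define m where "m v = ennreal (fisher_const haar (\<Phi> v) / fisher_const haar F *
    ((\<Prod>i=1..NZ. 1 / fisher_const haar (FZ i)) * (\<Prod>j=1..Nz. b j / (4 * pi * sinh (b j)))))" for v

  have f_exp: "f i r y = ennreal (1 / fisher_const haar (FZ i) * exp (r \<bullet> (y ** transpose (FZ i))))"
    for i r y
    unfolding f_def trace_attitude ..
  have g_exp: "g j r y = ennreal
      (b j / (4 * pi * sinh (b j)) * exp (r \<bullet> (b j *\<^sub>R outer_prod (B j *v a j) y)))" for j r y
    unfolding g_def inner_direction by simp
  have mult_meas[measurable]: "(\<lambda>y. y ** transpose (FZ i)) \<in> borel_measurable borel" for i
    unfolding matrix_matrix_mult_def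
    by (intro borel_measurable_continuous_onI continuous_on_vec_lambda continuous_intros)
  have outer_meas[measurable]: "outer_prod u \<in> borel_measurable borel" for u
    unfolding outer_prod_def matrix_matrix_mult_def columnvector_def rowvector_def
    by (intro borel_measurable_continuous_onI continuous_on_vec_lambda) (simp, intro continuous_intros)
  have f_meas: "(\<lambda>(r, y). f i r y) \<in> borel_measurable (haar \<Otimes>\<^sub>M haar)" for i
    unfolding f_exp by measurable
  have g_meas: "(\<lambda>(r, y). g j r y) \<in> borel_measurable (haar \<Otimes>\<^sub>M area_S2)" for j
    unfolding g_exp by measurable
  have \<Phi>_meas[measurable]: "\<Phi> \<in> borel_measurable ?T"
    unfolding \<Phi>_def by measurable
  have m_meas: "m \<in> borel_measurable ?T"
    unfolding m_def by measurable
  have Z_meas: "Z i \<in> measurable M haar" if "i \<in> {1..NZ}" for i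
    using attitude[OF that] by (simp add: cond_distr_def)
  have z_meas: "z j \<in> measurable M area_S2" if "j \<in> {1..Nz}" for j
    using direction[OF that] by (simp add: cond_distr_def)
  have obs_meas: "obs \<in> measurable M ?T"
    unfolding obs_def[abs_def] by (intro measurable_Pair measurable_restrict Z_meas z_meas)

  have c_nonneg: "0 \<le> (\<Prod>j=1..Nz. b j / (4 * pi * sinh (b j)))"
    using b by (intro prod_nonneg) (auto simp: less_imp_le)
  \<comment> \<open>the exponents add up to the linear form with matrix \<open>\<Phi> v\<close>; constants go into \<open>m\<close>\<close>
  have factor: "ennreal (fisher_density haar F r) *
      ((\<Prod>i=1..NZ. f i r (fst v i)) * (\<Prod>j=1..Nz. g j r (snd v j))) =
      ennreal (fisher_density haar (\<Phi> v) r) * m v" for r v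
  proof -
    have pos: "0 < fisher_const haar G" for G by (rule fisher_const_pos[OF haar])
    have "(\<Prod>i=1..NZ. f i r (fst v i)) = ennreal ((\<Prod>i=1..NZ. 1 / fisher_const haar (FZ i)) *
        exp (r \<bullet> (\<Sum>i=1..NZ. fst v i ** transpose (FZ i))))"
      unfolding f_exp using pos
      by (subst prod_ennreal) (auto simp: less_imp_le inner_sum_right exp_sum simp flip: prod.distrib)
    moreover have "(\<Prod>j=1..Nz. g j r (snd v j)) = ennreal ((\<Prod>j=1..Nz. b j / (4 * pi * sinh (b j))) *
        exp (r \<bullet> (\<Sum>j=1..Nz. b j *\<^sub>R outer_prod (B j *v a j) (snd v j))))"
      unfolding g_exp using b
      by (subst prod_ennreal)
        (auto simp: less_imp_le inner_sum_right exp_sum simp del: inner_scaleR_right simp flip: prod.distrib)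
    moreover have "exp (F \<bullet> r) * exp (r \<bullet> (\<Sum>i=1..NZ. fst v i ** transpose (FZ i))) *
        exp (r \<bullet> (\<Sum>j=1..Nz. b j *\<^sub>R outer_prod (B j *v a j) (snd v j))) = exp (\<Phi> v \<bullet> r)"
      by (simp add: \<Phi>_def inner_add_right inner_commute[of _ r] exp_add)
    ultimately show ?thesis
      using pos c_nonneg
      by (simp add: m_def fisher_density_def trace_transpose_mult less_imp_le prod_nonneg
          less_imp_neq[OF pos, symmetric] field_simps flip: ennreal_mult)
  qed

  have "distr M (haar \<Otimes>\<^sub>M ?T) (\<lambda>w. (R w, obs w)) = density (haar \<Otimes>\<^sub>M ?T)
      (\<lambda>(r, ys, vs). ennreal (fisher_density haar F r) *
        ((\<Prod>i=1..NZ. f i r (ys i)) * (\<Prod>j=1..Nz. g j r (vs j))))"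
    unfolding obs_def
  proof (rule joint_law_of_cond_indep[OF M _ _ haar.sigma_finite_measure_axioms
        haar.sigma_finite_measure_axioms area.sigma_finite_measure_axioms prior(1) _ _ f_meas g_meas _ _ indep])
    show "distr M haar R = density haar (\<lambda>r. ennreal (fisher_density haar F r))"
      using prior(2) by (simp only: matrix_fisher_def)
    show "(\<lambda>r. ennreal (fisher_density haar F r)) \<in> borel_measurable haar"
      unfolding fisher_density_def trace_transpose_mult by measurable
    show "cond_distr M haar (Z i) haar R (\<lambda>r. density haar (f i r))" if "i \<in> {1..NZ}" for i
      using attitude[OF that] by (simp only: f_def[abs_def])
    show "cond_distr M area_S2 (z j) haar R (\<lambda>r. density area_S2 (g j r))" if "j \<in> {1..Nz}" for j
      using direction[OF that] by (simp only: g_def[abs_def])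
  qed simp_all
  then have joint: "distr M (haar \<Otimes>\<^sub>M ?T) (\<lambda>w. (R w, obs w)) = density (haar \<Otimes>\<^sub>M ?T)
      (\<lambda>(r, v). ennreal (fisher_density haar (\<Phi> v) r) * m v)"
    by (simp only: factor[symmetric] case_prod_unfold)

  have "cond_distr M haar R ?T obs (\<lambda>v. density haar (\<lambda>r. ennreal (fisher_density haar (\<Phi> v) r)))"
  proof (rule cond_distr_of_joint_density[OF M haar.sigma_finite_measure_axioms
        AB.sigma_finite_measure_axioms prior(1) obs_meas _ _ m_meas joint])
    show "(\<lambda>v. density haar (\<lambda>r. ennreal (fisher_density haar (\<Phi> v) r))) \<in> measurable ?T (prob_algebra haar)"
      using measurable_compose[OF \<Phi>_meas matrix_fisher_kernel[OF haar]] by (simp add: matrix_fisher_def)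
    show "(\<lambda>(r, v). ennreal (fisher_density haar (\<Phi> v) r)) \<in> borel_measurable (haar \<Otimes>\<^sub>M ?T)"
      unfolding fisher_density_def trace_transpose_mult by measurable
  qed
  then show ?thesis
    by (simp only: obs_def[abs_def] \<Phi>_def matrix_fisher_def case_prod_unfold)
qed

end
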